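(* Let $\nu$ be a positive real number and let $L_{\alpha,\beta,n}$ denote the shifted Legendre polynomials on the interval $[\alpha,\beta]$. The (Caputo) fractional derivative of order $\nu$ of the shifted Legendre basis is $$D^\nu L_{\alpha,\beta,n}(x)=\sum_{i=0}^\infty S_\nu(n,i)\,L_{\alpha,\beta,i}(x),\qquad n=\lceil\nu\rceil,\lceil\nu\rceil+1,\dots,$$ where $\lceil\nu\rceil$ is the smallest integer greater than or equal to $\nu$ and $$S_\nu(n,i)=\sum_{k=0}^{[n/2]}\ \sum_{l=\lceil\nu\rceil}^{n-2k}\ \sum_{j=\lceil\nu\rceil}^{l}\frac{(-1)^{k-j+l}\,2^{l-n}\,\beta^{l-j}(\beta-\alpha)^{-l}\,(2n-2k)!\,j!}{(n-k)!\,k!\,(n-2k-l)!\,j!\,(l-j)!\,\Gamma(j+1-\nu)}\,c_{ij},$$ in which $$c_{ij}=\Big(i+\frac12\Big)\int_\alpha^\beta x^{j-\nu}L_{\alpha,\beta,i}(x)\,\mathrm dx .$$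
   Context: $L_k$ is the Legendre polynomial of degree $k$ on $[-1,1]$, normalized by $L_k(\pm1)=(\pm1)^k$. The shifted Legendre polynomials on $[\alpha,\beta]$ are $L_{\alpha,\beta,k}(x)=L_k\big(\tfrac{2}{\beta-\alpha}(x-\beta)+1\big)$, $k=0,1,\dots$. $[\cdot]$ is the integer part, $\Gamma$ is the Gamma function, and empty sums are $0$. $D^\nu$ is the Caputo fractional derivative of order $\nu$ (with base point $0$). It is linear, and on monomials it is given by $D^\nu x^k=0$ for integers $0\le k<\lceil\nu\rceil$ and $D^\nu x^k=\frac{\Gamma(k+1)}{\Gamma(k+1-\nu)}x^{k-\nu}$ for integers $k\ge\lceil\nu\rceil$.
   Formalization: The coefficient c_ij carries an additional factor 2/(β−α), without which the identity fails unless β−α=2 (e.g. ν=n=1 on [0,1]); and α≥0 is assumed when ν is not an integer, since x^(j−ν) and D^ν are undefined for x<0 then. *)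

theory Defs
  imports "HOL-Analysis.Analysis" "HOL-Computational_Algebra.Polynomial"
begin

(* Rodrigues' formula; this is the normalization with value (\<plusminus>1)^k at \<plusminus>1. *)
definition legendre_poly :: "nat \<Rightarrow> real poly" where
  "legendre_poly k =
     smult (1 / (2 ^ k * fact k)) ((pderiv ^^ k) ([:-1, 0, 1:] ^ k))"

definition shifted_legendre :: "real \<Rightarrow> real \<Rightarrow> nat \<Rightarrow> real \<Rightarrow> real" where
  "shifted_legendre \<alpha> \<beta> k x = poly (legendre_poly k) (2 / (\<beta> - \<alpha>) * (x - \<beta>) + 1)"

(* Caputo derivative with base point 0. For non-integer \<nu> it is only meaningful at x \<ge> 0;
   for integer \<nu> it is the ordinary derivative, at every real x. *)
definition caputo_deriv :: "real \<Rightarrow> (real \<Rightarrow> real) \<Rightarrow> real \<Rightarrow> real" where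
  "caputo_deriv \<nu> f x =
     (let m = nat \<lceil>\<nu>\<rceil> in
      if \<nu> \<in> \<int> then (deriv ^^ m) f x
      else 1 / Gamma (real m - \<nu>) *
           integral {0..x} (\<lambda>t. (x - t) powr (real m - \<nu> - 1) * (deriv ^^ m) f t))"

(* powr alone would not do: it is not the usual power for integer exponents at
   x < 0, and 0 powr 0 = 0. *)
definition real_power :: "real \<Rightarrow> real \<Rightarrow> real" where
  "real_power x a = (if a \<in> \<int> then x powi \<lfloor>a\<rfloor> else x powr a)"

(* The i-th shifted Legendre coefficient of x^(j - \<nu>) on [\<alpha>, \<beta>]. The squared norm of
   the i-th shifted Legendre polynomial is (\<beta> - \<alpha>) / (2 i + 1), hence the factor
   2 / (\<beta> - \<alpha>). The formula (i + 1/2) * integral, without this factor, is the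
   coefficient only for intervals of length 2: for \<nu> = n = 1 and [0, 1] the derivative
   is the constant 2, whereas the expansion without the factor gives 1. *)
definition legendre_coeff :: "real \<Rightarrow> real \<Rightarrow> real \<Rightarrow> nat \<Rightarrow> nat \<Rightarrow> real" where
  "legendre_coeff \<nu> \<alpha> \<beta> i j =
     2 / (\<beta> - \<alpha>) * ((real i + 1/2) *
       integral {\<alpha>..\<beta>} (\<lambda>x. real_power x (real j - \<nu>) * shifted_legendre \<alpha> \<beta> i x))"

definition S_coeff :: "real \<Rightarrow> real \<Rightarrow> real \<Rightarrow> nat \<Rightarrow> nat \<Rightarrow> real" where
  "S_coeff \<nu> \<alpha> \<beta> n i =
     (\<Sum>k = 0..n div 2. \<Sum>l = nat \<lceil>\<nu>\<rceil>..n - 2 * k. \<Sum>j = nat \<lceil>\<nu>\<rceil>..l.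
        ((-1) powi (int k - int j + int l) * 2 powi (int l - int n)
           * \<beta> ^ (l - j) * (\<beta> - \<alpha>) powi (- int l) * fact (2 * n - 2 * k) * fact j)
        / (fact (n - k) * fact k * fact (n - 2 * k - l) * fact j * fact (l - j)
           * Gamma (real j + 1 - \<nu>))
        * legendre_coeff \<nu> \<alpha> \<beta> i j)"

end

theory Submission
  imports Defs
begin

text \<open>
  Writing the shifted Legendre polynomial in monomials, \<open>D\<^sup>\<nu>\<close> turns each \<open>x\<^sup>j\<close> into a multiple of
  \<open>x powr (j - \<nu>)\<close> (by a Beta integral), so it suffices that the Legendre series of this power
  converges to it at every point of \<open>[\<alpha>, \<beta>]\<close>. For integer \<open>\<nu>\<close> the power is a polynomial and the
  series is finite. Otherwise, after an affine change of variables, the power is a multiple of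
  \<open>(t + s) powr a\<close> on \<open>[-1, 1]\<close> with \<open>a > 0\<close> and \<open>s \<ge> 1\<close>. Integrating by parts \<open>n\<close> times against
  Rodrigues' formula, the \<open>n\<close>-th coefficient contains \<open>(t + s) powr (a - n)\<close>, which for \<open>n > a\<close> is
  largest for \<open>s = 1\<close>; in that case the coefficients have an explicit ratio and their sum
  telescopes. As \<open>\<bar>L\<^sub>n\<bar> \<le> 1\<close>, the series converges uniformly, and its sum has the same Legendre
  coefficients as the power, hence equals it by Weierstrass approximation.
\<close>

section \<open>Iterated derivatives of monomials and of powers of linear factors\<close>

lemma higher_pderiv_monom_fact:
  fixes c :: real
  assumes "m \<le> n"
  shows "(pderiv ^^ m) (monom c n) = monom (fact n / fact (n - m) * c) (n - m)"
  using assms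
proof (induction m)
  case (Suc m)
  then have "n - m = Suc (n - Suc m)" by simp
  then have "fact (n - m) = (of_nat (n - m) :: real) * fact (n - Suc m)"
    by (metis fact_Suc)
  with Suc show ?case
    by (simp add: pderiv_monom field_simps)
qed simp

lemma higher_pderiv_eq_0:
  fixes p :: "real poly"
  assumes "degree p < m"
  shows "(pderiv ^^ m) p = 0"
  using assms by (intro poly_eqI) (simp add: coeff_higher_pderiv coeff_eq_0)

text \<open>Each differentiation costs one power of the linear factor, and at its root
  \<open>- c\<close> the cofactor is multiplied by the current exponent. For \<open>k < n\<close>
  this yields the zeros of the Rodrigues polynomials at the endpoints, for \<open>k = n\<close> the
  endpoint values of L_n.\<close>

lemma higher_pderiv_linear_power_mult:
  fixes R :: "real poly"
  assumes "k \<le> n"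
  shows "\<exists>R'. (pderiv ^^ k) ([:c, 1:] ^ n * R) = [:c, 1:] ^ (n - k) * R' \<and>
              poly R' (- c) = fact n / fact (n - k) * poly R (- c)"
  using assms
proof (induction k)
  case 0
  show ?case by (intro exI[of _ R]) simp
next
  case (Suc k)
  then obtain R' where R': "(pderiv ^^ k) ([:c, 1:] ^ n * R) = [:c, 1:] ^ (n - k) * R'"
    "poly R' (- c) = fact n / fact (n - k) * poly R (- c)" by auto
  define d where "d = n - Suc k"
  have d: "n - k = Suc d" using Suc.prems by (simp add: d_def)
  have "(pderiv ^^ Suc k) ([:c, 1:] ^ n * R) = pderiv ([:c, 1:] ^ Suc d * R')"
    using R'(1) d by simp
  also have "\<dots> = [:c, 1:] ^ d * ([:c, 1:] * pderiv R' + smult (real (Suc d)) R')"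
    unfolding pderiv_mult pderiv_power_Suc by (simp add: pderiv_pCons algebra_simps)
  finally have "(pderiv ^^ Suc k) ([:c, 1:] ^ n * R) =
      [:c, 1:] ^ d * ([:c, 1:] * pderiv R' + smult (real (Suc d)) R')" .
  moreover have "poly ([:c, 1:] * pderiv R' + smult (real (Suc d)) R') (- c) =
      fact n / fact d * poly R (- c)"
    by (simp add: R'(2) d fact_Suc del: of_nat_Suc)
  ultimately show ?case unfolding d_def by blast
qed

subsection \<open>Legendre polynomials via Rodrigues' formula\<close>

text \<open>The derivatives with \<open>k < n\<close> are kept because they are the antiderivatives
  in the repeated integration by parts; \<open>k = n\<close> is L_n up to a constant.\<close>

definition rodrigues :: "nat \<Rightarrow> nat \<Rightarrow> real poly" where
  "rodrigues n k = (pderiv ^^ k) ([:-1, 0, 1:] ^ n)"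

lemma rodrigues_0 [simp]: "rodrigues n 0 = [:-1, 0, 1:] ^ n"
  by (simp add: rodrigues_def)

lemma pderiv_rodrigues: "pderiv (rodrigues n k) = rodrigues n (Suc k)"
  by (simp add: rodrigues_def)

lemma higher_pderiv_rodrigues: "(pderiv ^^ m) (rodrigues n k) = rodrigues n (m + k)"
  by (simp add: rodrigues_def funpow_add)

lemma legendre_poly_rodrigues:
  "legendre_poly n = smult (1 / (2 ^ n * fact n)) (rodrigues n n)"
  by (simp add: legendre_poly_def rodrigues_def)

lemma rodrigues_factor:
  "([:-1, 0, 1:] :: real poly) ^ n = [:-1, 1:] ^ n * [:1, 1:] ^ n"
  by (simp flip: power_mult_distrib)

lemma rodrigues_dvd:
  assumes "k \<le> n"
  shows "[:1, 1:] ^ (n - k) dvd rodrigues n k" "[:-1, 1:] ^ (n - k) dvd rodrigues n k"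
proof -
  show "[:1, 1:] ^ (n - k) dvd rodrigues n k"
    using higher_pderiv_linear_power_mult[OF assms, of 1 "[:-1, 1:] ^ n"]
    unfolding rodrigues_def rodrigues_factor mult.commute[of "[:-1, 1:] ^ n"] by (metis dvdI)
  show "[:-1, 1:] ^ (n - k) dvd rodrigues n k"
    using higher_pderiv_linear_power_mult[OF assms, of "-1" "[:1, 1:] ^ n"]
    unfolding rodrigues_def rodrigues_factor by (metis dvdI)
qed

lemma poly_rodrigues_endpoints:
  assumes "k < n"
  shows "poly (rodrigues n k) 1 = 0" "poly (rodrigues n k) (- 1) = 0"
proof -
  have "[:1, 1:] dvd rodrigues n k" "[:-1, 1:] dvd rodrigues n k"
    using rodrigues_dvd[of k n] dvd_power[of "n - k"] assms dvd_trans
    by (metis less_imp_le zero_less_diff)+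
  then show "poly (rodrigues n k) 1 = 0" "poly (rodrigues n k) (- 1) = 0"
    by (simp_all add: poly_eq_0_iff_dvd)
qed

lemma poly_legendre_1: "poly (legendre_poly n) 1 = 1"
  using higher_pderiv_linear_power_mult[of n n "-1" "[:1, 1:] ^ n"]
  by (auto simp: legendre_poly_def rodrigues_factor)

lemma poly_legendre_minus_1: "poly (legendre_poly n) (- 1) = (- 1) ^ n"
proof -
  \<comment> \<open>The cofactor \<open>[:-1, 1:] ^ n\<close> takes this value at -1; the split
    isolates the \<open>2 ^ n\<close> that the normalization cancels.\<close>
  have "(- 2 :: real) ^ n = (- 1) ^ n * 2 ^ n"
    by (simp flip: power_mult_distrib)
  then show ?thesis
    using higher_pderiv_linear_power_mult[of n n 1 "[:-1, 1:] ^ n"]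
    by (auto simp: legendre_poly_def rodrigues_factor mult.commute)
qed

lemma degree_rodrigues: "degree (rodrigues n k) = 2 * n - k"
  by (simp add: rodrigues_def degree_higher_pderiv degree_power_eq)

lemma degree_legendre: "degree (legendre_poly n) = n"
  by (simp add: legendre_poly_rodrigues degree_rodrigues)

lemma lead_coeff_legendre: "coeff (legendre_poly n) n \<noteq> 0"
  by (metis degree_legendre leading_coeff_0_iff poly_0 poly_legendre_1 zero_neq_one)

section \<open>Legendre's differential equation and the bound by 1\<close>

text \<open>With u = (X^2 - 1)^n one has (X^2 - 1) u' = 2 n X u. Differentiating this
  \<open>k + 1\<close> times gives the identity: once in the base case, once more in each induction
  step. For \<open>k = n\<close> it is Legendre's equation.\<close>

lemma rodrigues_ode:
  "[:-1, 0, 1:] * rodrigues n (Suc (Suc k))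
     + smult (2 * (real k + 1 - real n)) ([:0, 1:] * rodrigues n (Suc k))
     + smult ((real k + 1) * (real k - 2 * real n)) (rodrigues n k) = 0"
proof (induction k)
  case 0
  define u :: "real poly" where "u = [:-1, 0, 1:] ^ n"
  have 1: "[:-1, 0, 1:] * pderiv u = smult (2 * real n) ([:0, 1:] * u)"
  proof (cases n)
    case (Suc m)
    have "pderiv ([:-1, 0, 1:] :: real poly) = [:0, 2:]"
      by (simp add: pderiv_pCons)
    then show ?thesis
      unfolding u_def Suc pderiv_power_Suc
      by (simp add: algebra_simps)
  qed (simp add: u_def)
  have "pderiv ([:-1, 0, 1:] * pderiv u) = pderiv (smult (2 * real n) ([:0, 1:] * u))"
    using 1 by simp
  then have "poly (pderiv ([:-1, 0, 1:] * pderiv u)) x =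
    poly (pderiv (smult (2 * real n) ([:0, 1:] * u))) x" for x by simp
  then have 2: "poly u x * (real n * 2) + poly (pderiv u) x * (x * (real n * 2)) =
      poly (pderiv u) x * (x * 2) + poly (pderiv (pderiv u)) x * (x * x - 1)" for x
    by (simp add: pderiv_mult pderiv_smult pderiv_diff pderiv_pCons algebra_simps)
  show ?case
    using 2 by (simp add: rodrigues_def poly_eq_poly_eq_iff[symmetric] fun_eq_iff
        flip: u_def) (simp add: algebra_simps)
next
  case (Suc k)
  have "pderiv ([:-1, 0, 1:] * rodrigues n (Suc (Suc k))
     + smult (2 * (real k + 1 - real n)) ([:0, 1:] * rodrigues n (Suc k))
     + smult ((real k + 1) * (real k - 2 * real n)) (rodrigues n k)) = 0"
    by (simp only: Suc pderiv_0)
  then have *: "poly (pderiv ([:-1, 0, 1:] * rodrigues n (Suc (Suc k))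
     + smult (2 * (real k + 1 - real n)) ([:0, 1:] * rodrigues n (Suc k))
     + smult ((real k + 1) * (real k - 2 * real n)) (rodrigues n k))) x = 0" for x
    by simp
  have "poly ([:-1, 0, 1:] * rodrigues n (Suc (Suc (Suc k)))
     + smult (2 * (real (Suc k) + 1 - real n)) ([:0, 1:] * rodrigues n (Suc (Suc k)))
     + smult ((real (Suc k) + 1) * (real (Suc k) - 2 * real n)) (rodrigues n (Suc k))) x = 0" for x
    using *[of x]
    by (simp add: pderiv_add pderiv_mult pderiv_smult pderiv_pCons pderiv_diff pderiv_rodrigues)
      algebra
  then show ?case
    by (simp only: poly_eq_poly_eq_iff[symmetric] fun_eq_iff poly_0 simp_thms)
qed

lemma legendre_ode:
  fixes t :: real and n :: nat
  defines "p \<equiv> legendre_poly n"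
  shows "(1 - t\<^sup>2) * poly (pderiv (pderiv p)) t =
    2 * t * poly (pderiv p) t - real n * (real n + 1) * poly p t"
proof -
  define c :: real where "c = 1 / (2 ^ n * fact n)"
  have "poly ([:-1, 0, 1:] * rodrigues n (Suc (Suc n))
     + smult (2 * (real n + 1 - real n)) ([:0, 1:] * rodrigues n (Suc n))
     + smult ((real n + 1) * (real n - 2 * real n)) (rodrigues n n)) t = 0"
    by (subst rodrigues_ode) simp
  then have "(1 - t\<^sup>2) * poly (rodrigues n (Suc (Suc n))) t =
      2 * t * poly (rodrigues n (Suc n)) t - real n * (real n + 1) * poly (rodrigues n n) t"
    by (simp add: algebra_simps power2_eq_square)
  then have "(1 - t\<^sup>2) * (c * poly (rodrigues n (Suc (Suc n))) t) =
      2 * t * (c * poly (rodrigues n (Suc n)) t)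
        - real n * (real n + 1) * (c * poly (rodrigues n n) t)"
    by algebra
  then show ?thesis
    by (simp add: p_def legendre_poly_rodrigues pderiv_smult pderiv_rodrigues flip: c_def)
qed

lemma abs_legendre_le_1:
  fixes t :: real
  assumes "t \<in> {-1..1}"
  shows "\<bar>poly (legendre_poly n) t\<bar> \<le> 1"
\<comment> \<open>For \<open>n = 0\<close> the divisor \<open>N\<close> below would be 0.\<close>
proof (cases "n = 0")
  case True
  then show ?thesis by (simp add: legendre_poly_def)
next
  case False
  define p where "p = legendre_poly n"
  define N where "N = real n * (real n + 1)"
  txt \<open>The differential equation makes this function monotone on either side of 0, and its
    value at both endpoints is 1.\<close>
  define \<phi> where "\<phi> t = (poly p t)\<^sup>2 + (1 - t\<^sup>2) * (poly (pderiv p) t)\<^sup>2 / N" for t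
  have N: "N > 0" using False by (simp add: N_def)
  have deriv: "(\<phi> has_real_derivative 2 * t * (poly (pderiv p) t)\<^sup>2 / N) (at t)" for t
  proof -
    have "(\<phi> has_real_derivative 2 * poly p t * poly (pderiv p) t +
      (- 2 * t * (poly (pderiv p) t)\<^sup>2
        + 2 * poly (pderiv p) t * ((1 - t\<^sup>2) * poly (pderiv (pderiv p)) t)) / N) (at t)"
      unfolding \<phi>_def using N
      by (auto intro!: derivative_eq_intros simp: field_simps power2_eq_square)
    also have "(1 - t\<^sup>2) * poly (pderiv (pderiv p)) t =
        2 * t * poly (pderiv p) t - N * poly p t"
      unfolding p_def N_def by (rule legendre_ode)
    also have "2 * poly p t * poly (pderiv p) t +
      (- 2 * t * (poly (pderiv p) t)\<^sup>2
        + 2 * poly (pderiv p) t * (2 * t * poly (pderiv p) t - N * poly p t)) / N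
      = 2 * t * (poly (pderiv p) t)\<^sup>2 / N"
      using N by (simp add: field_simps power2_eq_square)
    finally show ?thesis .
  qed
  have "\<phi> t \<le> 1"
  proof (cases "t \<ge> 0")
    case True
    have "\<phi> t \<le> \<phi> 1"
    proof (rule DERIV_nonneg_imp_nondecreasing[where f = \<phi>])
      show "\<exists>y. DERIV \<phi> u :> y \<and> y \<ge> 0" if "t \<le> u" for u
        using deriv[of u] that True N
        by (intro exI[of _ "2 * u * (poly (pderiv p) u)\<^sup>2 / N"]) auto
    qed (use assms in auto)
    then show ?thesis by (simp add: \<phi>_def p_def poly_legendre_1)
  next
    case False
    have "\<phi> t \<le> \<phi> (-1)"
    proof (rule DERIV_nonpos_imp_nonincreasing[where f = \<phi>])
      show "\<exists>y. DERIV \<phi> u :> y \<and> y \<le> 0" if "u \<le> t" for u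
        using deriv[of u] that False N
        by (intro exI[of _ "2 * u * (poly (pderiv p) u)\<^sup>2 / N"]) (auto simp: divide_nonpos_pos mult_nonpos_nonneg)
    qed (use assms in auto)
    then show ?thesis
      by (simp add: \<phi>_def p_def poly_legendre_minus_1 flip: power_mult)
  qed
  moreover have "(poly p t)\<^sup>2 \<le> \<phi> t"
    using assms N by (auto simp: \<phi>_def abs_square_le_1 abs_le_iff)
  ultimately have "(poly p t)\<^sup>2 \<le> 1" by simp
  then show ?thesis by (simp add: p_def abs_square_le_1)
qed

section \<open>Integration by parts against Rodrigues' formula; orthogonality and norms\<close>

text \<open>Boundary terms vanish because \<open>rodrigues n k\<close> is 0 at both endpoints for
  \<open>k < n\<close>. The derivatives \<open>h k\<close> are passed as a family, differentiable
  only in the interior, so that they may be singular at -1 like (t + 1) powr (a - k);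
  \<open>cont\<close> says that a factor (X + 1)^k compensates the singularity, and
  \<open>rodrigues n (n - k)\<close> has this factor.\<close>

lemma integral_mult_rodrigues:
  assumes deriv: "\<And>k t. k < n \<Longrightarrow> t \<in> {-1<..<1} \<Longrightarrow>
      (h k has_real_derivative h (Suc k) t) (at t)"
    and cont: "\<And>k p. k \<le> n \<Longrightarrow> [:1, 1:] ^ k dvd p \<Longrightarrow>
      continuous_on {-1..1} (\<lambda>t. h k t * poly p t)"
  shows "integral {-1..1} (\<lambda>t. h 0 t * poly (rodrigues n n) t) =
    (- 1) ^ n * integral {-1..1} (\<lambda>t. h n t * poly (rodrigues n 0) t)"
proof -
  have dvd: "[:1, 1:] ^ k dvd rodrigues n (n - k)" if "k \<le> n" for k
    using rodrigues_dvd(1)[of "n - k" n] that by simp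
  have "integral {-1..1} (\<lambda>t. h 0 t * poly (rodrigues n n) t) =
    (- 1) ^ k * integral {-1..1} (\<lambda>t. h k t * poly (rodrigues n (n - k)) t)" if "k \<le> n" for k
    using that
  proof (induction k)
    case (Suc k)
    define q where "q = rodrigues n (n - Suc k)"
    have q: "pderiv q = rodrigues n (n - k)"
      using Suc.prems by (simp add: q_def pderiv_rodrigues Suc_diff_Suc)
    have dq: "[:1, 1:] ^ Suc k dvd q"
      unfolding q_def by (rule dvd) fact
    \<comment> \<open>The power \<open>k\<close> makes \<open>h k * q\<close> continuous; the power
      \<open>Suc k\<close> of \<open>dq\<close> is for the new integrand
      \<open>h (Suc k) * q\<close>.\<close>
    have dq': "[:1, 1:] ^ k dvd q"
      using dq by (rule power_le_dvd) simp
    have "((\<lambda>t. h (Suc k) t * poly q t + h k t * poly (pderiv q) t) has_integral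
        h k 1 * poly q 1 - h k (-1) * poly q (-1)) {-1..1}"
    proof (rule fundamental_theorem_of_calculus_interior)
      show "continuous_on {-1..1} (\<lambda>t. h k t * poly q t)"
        using Suc.prems dq' by (intro cont) auto
      show "((\<lambda>t. h k t * poly q t) has_vector_derivative
          h (Suc k) t * poly q t + h k t * poly (pderiv q) t) (at t)" if "t \<in> {-1<..<1}" for t
        unfolding has_real_derivative_iff_has_vector_derivative[symmetric]
        using Suc.prems that
        by (auto intro!: derivative_eq_intros deriv)
    qed auto
    moreover have "h k 1 * poly q 1 - h k (-1) * poly q (-1) = 0"
      using Suc.prems by (simp add: q_def poly_rodrigues_endpoints)
    ultimately have "integral {-1..1} (\<lambda>t. h (Suc k) t * poly q t + h k t * poly (pderiv q) t) = 0"
      by (simp add: integral_unique)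
    moreover have "integral {-1..1} (\<lambda>t. h (Suc k) t * poly q t + h k t * poly (pderiv q) t) =
      integral {-1..1} (\<lambda>t. h (Suc k) t * poly q t) + integral {-1..1} (\<lambda>t. h k t * poly (pderiv q) t)"
      using Suc.prems dvd[of k] dq
      by (intro Henstock_Kurzweil_Integration.integral_add integrable_continuous_real cont) (auto simp: q)
    ultimately show ?case
      using Suc by (simp add: q_def[symmetric] q[symmetric] eq_neg_iff_add_eq_0 flip: distrib_left)
  qed simp
  from this[of n] show ?thesis by simp
qed

lemma integral_poly_mult_rodrigues:
  "integral {-1..1} (\<lambda>t. poly p t * poly (rodrigues n n) t) =
    (- 1) ^ n * integral {-1..1} (\<lambda>t. poly ((pderiv ^^ n) p) t * poly (rodrigues n 0) t)"
  using integral_mult_rodrigues[of n "\<lambda>k t. poly ((pderiv ^^ k) p) t",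
      OF _ continuous_on_mult[OF continuous_on_poly continuous_on_poly]]
  by (simp add: continuous_on_id)

lemma integral_mult_legendre:
  "integral {-1..1} (\<lambda>t. f t * poly (legendre_poly n) t) =
    integral {-1..1} (\<lambda>t. f t * poly (rodrigues n n) t) / (2 ^ n * fact n)"
proof -
  have "integral {-1..1} (\<lambda>t. f t * poly (legendre_poly n) t) =
    integral {-1..1} (\<lambda>t. 1 / (2 ^ n * fact n) * (f t * poly (rodrigues n n) t))"
    by (simp add: legendre_poly_rodrigues)
  also have "\<dots> = 1 / (2 ^ n * fact n) * integral {-1..1} (\<lambda>t. f t * poly (rodrigues n n) t)"
    by (rule integral_mult_right)
  finally show ?thesis by simp
qed

lemma integral_poly_mult_legendre_eq_0:
  assumes "degree p < n"
  shows "integral {-1..1} (\<lambda>t. poly p t * poly (legendre_poly n) t) = 0"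
  by (simp add: integral_mult_legendre integral_poly_mult_rodrigues higher_pderiv_eq_0 assms)

lemma legendre_orthogonal:
  assumes "m \<noteq> n"
  shows "integral {-1..1} (\<lambda>t. poly (legendre_poly m) t * poly (legendre_poly n) t) = 0"
proof (cases "m < n")
  case True
  then show ?thesis
    by (simp add: integral_poly_mult_legendre_eq_0 degree_legendre)
next
  case False
  then have "integral {-1..1} (\<lambda>t. poly (legendre_poly n) t * poly (legendre_poly m) t) = 0"
    using assms by (simp add: integral_poly_mult_legendre_eq_0 degree_legendre)
  then show ?thesis by (simp add: mult.commute)
qed

text \<open>The function t (1 - t^2)^(n+1) vanishes at both endpoints, and its derivative is a
  combination of the integrands for \<open>n\<close> and \<open>Suc n\<close>; this gives the
  recursion.\<close>

lemma integral_one_minus_square_power: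
  "integral {-1..1} (\<lambda>t::real. (1 - t\<^sup>2) ^ n) = 2 * (2 ^ n * fact n)\<^sup>2 / fact (2 * n + 1)"
proof (induction n)
  case (Suc n)
  have int: "(\<lambda>t::real. (1 - t\<^sup>2) ^ k) integrable_on {-1..1}" for k
    by (intro integrable_continuous_real continuous_intros)
  have "((\<lambda>t::real. (2 * n + 3) * (1 - t\<^sup>2) ^ Suc n - (2 * n + 2) * (1 - t\<^sup>2) ^ n) has_integral
      1 * (1 - 1\<^sup>2) ^ Suc n - (-1) * (1 - (-1)\<^sup>2) ^ Suc n) {-1..1}"
  proof (rule fundamental_theorem_of_calculus_interior)
    show "((\<lambda>t. t * (1 - t\<^sup>2) ^ Suc n) has_vector_derivative
        (2 * n + 3) * (1 - t\<^sup>2) ^ Suc n - (2 * n + 2) * (1 - t\<^sup>2) ^ n) (at t)" for t :: real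
      unfolding has_real_derivative_iff_has_vector_derivative[symmetric]
      by (rule derivative_eq_intros refl)+ (simp add: algebra_simps power2_eq_square)
  qed (auto intro!: continuous_intros)
  then have "integral {-1..1} (\<lambda>t::real. (2 * n + 3) * (1 - t\<^sup>2) ^ Suc n - (2 * n + 2) * (1 - t\<^sup>2) ^ n) = 0"
    by (simp add: integral_unique)
  then have "(2 * n + 3) * integral {-1..1} (\<lambda>t::real. (1 - t\<^sup>2) ^ Suc n) =
    (2 * n + 2) * integral {-1..1} (\<lambda>t::real. (1 - t\<^sup>2) ^ n)"
    using int[of n] int[of "Suc n"]
    by (subst (asm) Henstock_Kurzweil_Integration.integral_diff)
      (auto intro!: integrable_on_mult_right simp del: power_Suc)
  moreover have "(2 * real n + 2) * (2 * (2 ^ n * fact n)\<^sup>2 / fact (2 * n + 1)) =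
     (2 * real n + 3) * (2 * (2 ^ Suc n * fact (Suc n))\<^sup>2 / fact (2 * Suc n + 1) :: real)"
  proof -
    have "fact (2 * Suc n + 1) = (2 * real n + 3) * (2 * (real n + 1)) * fact (2 * n + 1)"
      by (simp add: algebra_simps)
    then show ?thesis by (simp add: power2_eq_square divide_simps) (simp add: algebra_simps)
  qed
  ultimately have "(2 * real n + 3) * integral {-1..1} (\<lambda>t::real. (1 - t\<^sup>2) ^ Suc n) =
     (2 * real n + 3) * (2 * (2 ^ Suc n * fact (Suc n))\<^sup>2 / fact (2 * Suc n + 1))"
    unfolding Suc.IH by (simp only: of_nat_add of_nat_mult of_nat_numeral)
  then show ?case
    by (rule mult_left_cancel[THEN iffD1, rotated]) simp
qed simp

text \<open>Moving \<open>n\<close> derivatives from one Rodrigues factor to the other turns the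
  latter into the constant (2n)!, the \<open>2 * n\<close>-th derivative of a monic polynomial of
  that degree. What remains is the integral of (1 - t^2)^n.\<close>

lemma legendre_norm:
  "integral {-1..1} (\<lambda>t. poly (legendre_poly n) t * poly (legendre_poly n) t) = 2 / (2 * real n + 1)"
proof -
  have "rodrigues n (2 * n) = [:fact (2 * n):]"
  proof (rule poly_eqI)
    have lead: "coeff (([:-1, 0, 1:] :: real poly) ^ n) (2 * n) = 1"
      using lead_coeff_power[of "[:-1, 0, 1:] :: real poly" n] by (simp add: degree_power_eq mult_2)
    have "coeff (([:-1, 0, 1:] :: real poly) ^ n) (Suc (k + 2 * n)) = 0" for k
      by (intro coeff_eq_0) (simp add: degree_power_eq)
    with lead show "coeff (rodrigues n (2 * n)) k = coeff [:fact (2 * n):] k" for k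
      by (cases k) (auto simp: rodrigues_def coeff_higher_pderiv pochhammer_fact)
  qed
  then have "(pderiv ^^ n) (rodrigues n n) = [:fact (2 * n):]"
    by (simp add: higher_pderiv_rodrigues mult_2)
  moreover have "poly (rodrigues n 0) t = (- 1) ^ n * (1 - t\<^sup>2) ^ n" for t
    by (simp add: poly_power power2_eq_square flip: power_mult_distrib)
  ultimately have "integral {-1..1} (\<lambda>t. poly (rodrigues n n) t * poly (rodrigues n n) t) =
     (- 1) ^ n * integral {-1..1} (\<lambda>t. (fact (2 * n) * (- 1) ^ n) * (1 - t\<^sup>2) ^ n)"
    by (simp add: integral_poly_mult_rodrigues mult.assoc)
  also have "\<dots> = fact (2 * n) * integral {-1..1} (\<lambda>t::real. (1 - t\<^sup>2) ^ n)"
    by (subst integral_mult_right) (simp add: mult.assoc[symmetric] mult.commute flip: power_mult_distrib)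
  also have "\<dots> = 2 * (2 ^ n * fact n)\<^sup>2 / (2 * real n + 1)"
  proof -
    have "fact (2 * n + 1) = (2 * real n + 1) * fact (2 * n)" by simp
    then show ?thesis
      unfolding integral_one_minus_square_power by (simp only:) simp
  qed
  finally have *: "integral {-1..1} (\<lambda>t. poly (rodrigues n n) t * poly (rodrigues n n) t) =
    2 * (2 ^ n * fact n)\<^sup>2 / (2 * real n + 1)" .
  \<comment> \<open>The normalizing constant is pulled out of one factor at a time.\<close>
  have "integral {-1..1} (\<lambda>t. poly (legendre_poly n) t * poly (legendre_poly n) t) =
      integral {-1..1} (\<lambda>t. poly (rodrigues n n) t * poly (legendre_poly n) t) / (2 ^ n * fact n)"
    unfolding integral_mult_legendre[of "poly (legendre_poly n)"]
    by (simp only: mult.commute[of "poly (legendre_poly n) _"])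
  also have "\<dots> = 2 / (2 * real n + 1)"
    unfolding integral_mult_legendre[of "poly (rodrigues n n)"] *
    by (simp add: power2_eq_square)
  finally show ?thesis .
qed

subsection \<open>Completeness and uniformly convergent expansions\<close>

text \<open>Orthogonality to every L_n extends to all polynomials by induction on the degree.
  Approximating \<open>h\<close> uniformly by polynomials then forces the integral of h^2 to be
  0.\<close>

lemma legendre_complete:
  assumes cont: "continuous_on {-1..1} h"
    and orth: "\<And>n. integral {-1..1} (\<lambda>t. h t * poly (legendre_poly n) t) = 0"
    and "t \<in> {-1..1}"
  shows "h t = 0"
proof -
  have poly: "integral {-1..1} (\<lambda>t. h t * poly p t) = 0" for p
  proof (induction "degree p" arbitrary: p rule: less_induct)
    case less
    define L where "L = legendre_poly (degree p)"
    \<comment> \<open>With this \<open>c\<close>, subtracting \<open>c * L\<close> cancels the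
      leading term, so the degree drops; in degree 0, where it cannot, \<open>q\<close> is
      0.\<close>
    define c where "c = lead_coeff p / lead_coeff L"
    define q where "q = p - smult c L"
    have L: "degree L = degree p" "lead_coeff L \<noteq> 0"
      using lead_coeff_legendre[of "degree p"] by (auto simp: L_def degree_legendre)
    have "coeff q (degree p) = 0"
      using L by (simp add: q_def c_def)
    have "integral {-1..1} (\<lambda>t. h t * poly q t) = 0"
    proof (cases "degree p = 0")
      case True
      then have "q = 0" using \<open>coeff q (degree p) = 0\<close> L
        by (metis degree_0_id degree_diff_le degree_smult_le le_zero_eq of_nat_0 pCons_0_0 q_def coeff_0 leading_coeff_0_iff)
      then show ?thesis by simp
    next
      case False
      have "degree q \<le> degree p" unfolding q_def
        using L by (intro degree_diff_le) (auto intro: order_trans[OF degree_smult_le])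
      with \<open>coeff q (degree p) = 0\<close> False have "degree q < degree p"
        by (metis leading_coeff_0_iff le_neq_implies_less degree_0 gr0I)
      then show ?thesis by (rule less)
    qed
    moreover have "h t * poly p t = h t * poly q t + c * (h t * poly L t)" for t
      by (simp add: q_def algebra_simps)
    moreover have "integral {-1..1} (\<lambda>t. h t * poly q t + c * (h t * poly L t)) =
      integral {-1..1} (\<lambda>t. h t * poly q t) + c * integral {-1..1} (\<lambda>t. h t * poly L t)"
      by (subst Henstock_Kurzweil_Integration.integral_add)
        (auto intro!: integrable_continuous_real continuous_intros cont)
    ultimately show ?case
      using orth[of "degree p"] by (simp add: L_def)
  qed
  have "integral {-1..1} (\<lambda>t. h t * h t) \<le> e * integral {-1..1} (\<lambda>t. \<bar>h t\<bar>)" if "e > 0" for e :: real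
  proof -
    obtain g where g: "real_polynomial_function g" "\<And>t. t \<in> {-1..1} \<Longrightarrow> \<bar>h t - g t\<bar> < e"
      using Stone_Weierstrass_real_polynomial_function[OF _ cont \<open>e > 0\<close>] by auto
    then obtain a m where am: "g = (\<lambda>x. \<Sum>i\<le>m. a i * x ^ i)"
      by (auto simp: real_polynomial_function_iff_sum)
    define p where "p = (\<Sum>i\<le>m. monom (a i) i)"
    have gp: "g t = poly p t" for t
      by (simp add: am p_def poly_sum poly_monom)
    \<comment> \<open>The part \<open>h * p\<close> integrates to 0 and \<open>h - p\<close> is
      smaller than \<open>e\<close>.\<close>
    have "integral {-1..1} (\<lambda>t. h t * h t) =
       integral {-1..1} (\<lambda>t. h t * (h t - poly p t) + h t * poly p t)"
      by (simp add: algebra_simps)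
    also have "\<dots> = integral {-1..1} (\<lambda>t. h t * (h t - poly p t)) + integral {-1..1} (\<lambda>t. h t * poly p t)"
      by (intro Henstock_Kurzweil_Integration.integral_add integrable_continuous_real continuous_intros cont)
    also have "\<dots> = integral {-1..1} (\<lambda>t. h t * (h t - poly p t))"
      by (simp add: poly)
    also have "\<dots> \<le> integral {-1..1} (\<lambda>t. e * \<bar>h t\<bar>)"
    proof (rule integral_le)
      show "h t * (h t - poly p t) \<le> e * \<bar>h t\<bar>" if "t \<in> {-1..1}" for t
      proof -
        have "h t * (h t - poly p t) \<le> \<bar>h t\<bar> * \<bar>h t - poly p t\<bar>"
          by (simp flip: abs_mult)
        also have "\<dots> \<le> \<bar>h t\<bar> * e"
          using g(2)[OF that] by (intro mult_left_mono) (auto simp: gp)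
        finally show ?thesis by (simp add: mult.commute)
      qed
    qed (intro integrable_continuous_real continuous_intros cont)+
    finally show ?thesis by simp
  qed
  then have "integral {-1..1} (\<lambda>t. h t * h t) \<le> 0"
  proof -
    assume *: "\<And>e. e > 0 \<Longrightarrow> integral {-1..1} (\<lambda>t. h t * h t) \<le> e * integral {-1..1} (\<lambda>t. \<bar>h t\<bar>)"
    \<comment> \<open>Let \<open>e\<close> tend to 0 from the right.\<close>
    have "((\<lambda>e. e * integral {-1..1} (\<lambda>t. \<bar>h t\<bar>)) \<longlongrightarrow> 0 * integral {-1..1} (\<lambda>t. \<bar>h t\<bar>)) (at_right 0)"
      by (intro tendsto_intros)
    then show ?thesis
      using * by (intro tendsto_lowerbound[where F = "at_right (0::real)"])
        (auto simp: eventually_at_filter)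
  qed
  moreover have "integral {-1..1} (\<lambda>t. h t * h t) \<ge> 0"
    by (rule integral_nonneg) (auto intro!: integrable_continuous_real continuous_intros cont)
  ultimately have "integral {-1..1} (\<lambda>t. h t * h t) = 0" by simp
  then have "\<forall>t\<in>{-1..1}. h t * h t = 0"
    by (subst (asm) integral_eq_0_iff) (auto intro!: continuous_intros cont)
  then show ?thesis using assms(3) by auto
qed

text \<open>The factor \<open>i + 1/2\<close> is the reciprocal of the squared norm of L_i on
  [-1, 1].\<close>

definition legendre_fourier :: "(real \<Rightarrow> real) \<Rightarrow> nat \<Rightarrow> real" where
  "legendre_fourier g i = (real i + 1/2) * integral {-1..1} (\<lambda>t. g t * poly (legendre_poly i) t)"

text \<open>As L_i is bounded by 1, absolute summability makes the series converge uniformly to a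
  continuous \<open>G\<close>. Termwise integration shows that \<open>G\<close> has the Legendre
  coefficients of \<open>g\<close>, so completeness applies to \<open>g - G\<close>.\<close>

theorem legendre_series_sums:
  assumes cont: "continuous_on {-1..1} g"
    and summable: "summable (\<lambda>i. \<bar>legendre_fourier g i\<bar>)"
    and t: "t \<in> {-1..1}"
  shows "(\<lambda>i. legendre_fourier g i * poly (legendre_poly i) t) sums g t"
proof -
  define d where "d = legendre_fourier g"
  define G where "G t = (\<Sum>i. d i * poly (legendre_poly i) t)" for t
  have bound: "norm (d i * poly (legendre_poly i) t) \<le> \<bar>d i\<bar>" if "t \<in> {-1..1}" for i t
    using abs_legendre_le_1[OF that] by (simp add: abs_mult mult_left_le)
  have unif: "uniform_limit {-1..1} (\<lambda>n t. \<Sum>i<n. d i * poly (legendre_poly i) t) G sequentially"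
    unfolding G_def using bound summable[folded d_def] by (rule Weierstrass_m_test)
  have contG: "continuous_on {-1..1} G"
    by (rule uniform_limit_theorem[OF _ unif]) (auto intro!: always_eventually continuous_intros)
  have coeff: "integral {-1..1} (\<lambda>t. G t * poly (legendre_poly k) t) = 2 / (2 * real k + 1) * d k" for k
  proof -
    let ?L = "\<lambda>t. poly (legendre_poly k) t"
    have bdd: "bounded (?L ` {-1..1})"
      using abs_legendre_le_1 by (auto simp: bounded_iff intro!: exI[of _ 1])
    have "bounded (G ` {-1..1})"
      by (intro compact_imp_bounded compact_continuous_image contG) simp
    then have "uniform_limit {-1..1} (\<lambda>n t. (\<Sum>i<n. d i * poly (legendre_poly i) t) * ?L t)
        (\<lambda>t. G t * ?L t) sequentially"
      using bdd by (intro uniform_lim_mult unif uniform_limit_const)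
    then obtain I J where IJ: "\<And>n. ((\<lambda>t. (\<Sum>i<n. d i * poly (legendre_poly i) t) * ?L t) has_integral I n) {-1..1}"
      "((\<lambda>t. G t * ?L t) has_integral J) {-1..1}" "I \<longlonglongrightarrow> J"
      by (rule uniform_limit_integral) (auto intro!: continuous_intros)
    \<comment> \<open>By orthogonality only the term \<open>i = k\<close> survives, so the sequence
      is constant once the partial sum contains it.\<close>
    have "I n = 2 / (2 * real k + 1) * d k" if "n > k" for n
    proof -
      have "I n = integral {-1..1} (\<lambda>t. (\<Sum>i<n. d i * poly (legendre_poly i) t) * ?L t)"
        by (rule integral_unique[OF IJ(1), symmetric])
      also have "\<dots> = integral {-1..1} (\<lambda>t. \<Sum>i<n. d i * (poly (legendre_poly i) t * ?L t))"
        by (simp add: sum_distrib_right mult.assoc)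
      also have "\<dots> = (\<Sum>i<n. d i * integral {-1..1} (\<lambda>t. poly (legendre_poly i) t * ?L t))"
        by (subst Henstock_Kurzweil_Integration.integral_sum)
          (auto intro!: integrable_continuous_real continuous_intros)
      also have "\<dots> = (\<Sum>i<n. if i = k then d k * (2 / (2 * real k + 1)) else 0)"
        by (intro sum.cong) (auto simp: legendre_norm legendre_orthogonal)
      also have "\<dots> = 2 / (2 * real k + 1) * d k"
        using that by simp
      finally show ?thesis .
    qed
    then have "I \<longlonglongrightarrow> 2 / (2 * real k + 1) * d k"
      by (intro tendsto_eventually) (auto simp: eventually_sequentially intro!: exI[of _ "Suc k"])
    with IJ(3) have "J = 2 / (2 * real k + 1) * d k"
      by (rule LIMSEQ_unique)
    with IJ(2) show ?thesis by (simp add: integral_unique)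
  qed
  have "g t - G t = 0"
  proof (rule legendre_complete[where h = "\<lambda>t. g t - G t"])
    show "integral {-1..1} (\<lambda>t. (g t - G t) * poly (legendre_poly k) t) = 0" for k
    proof -
      have "integral {-1..1} (\<lambda>t. (g t - G t) * poly (legendre_poly k) t) =
        integral {-1..1} (\<lambda>t. g t * poly (legendre_poly k) t) -
        integral {-1..1} (\<lambda>t. G t * poly (legendre_poly k) t)"
        unfolding left_diff_distrib
        by (intro Henstock_Kurzweil_Integration.integral_diff integrable_continuous_real
            continuous_intros cont contG)
      then show ?thesis
        by (simp add: coeff d_def legendre_fourier_def field_simps)
    qed
  qed (use t in \<open>auto intro!: continuous_intros cont contG\<close>)
  moreover have "summable (\<lambda>i. d i * poly (legendre_poly i) t)"
    by (rule summable_comparison_test'[OF summable[folded d_def] bound[OF t]])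
  ultimately show ?thesis
    using summable_sums by (fastforce simp: G_def d_def)
qed

subsection \<open>Expansion of powers\<close>

text \<open>For \<open>s > 1\<close> the base stays positive. For \<open>s = 1\<close> the factor (t
  + 1)^k raises the possibly negative exponent \<open>a - k\<close> to \<open>a > 0\<close>.\<close>

lemma continuous_on_shifted_powr_mult_poly:
  fixes a s :: real
  assumes "a > 0" "s \<ge> 1" "[:1, 1:] ^ k dvd p"
  shows "continuous_on {-1..1} (\<lambda>t. (t + s) powr (a - real k) * poly p t)"
proof -
  obtain R where R: "p = [:1, 1:] ^ k * R" using assms(3) by (auto simp: dvd_def)
  show ?thesis
  proof (cases "s = 1")
    case True
    have "continuous_on {-1..1} (\<lambda>t::real. (t + 1) powr a * poly R t)"
      using assms(1) by (intro continuous_intros continuous_on_powr') auto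
    moreover have "(t + 1) powr a * poly R t = (t + s) powr (a - real k) * poly p t"
      if "t \<in> {-1..1}" for t
    \<comment> \<open>At -1 both sides are 0, since 0 powr anything is 0.\<close>
    proof (cases "t = -1")
      case False
      then have "(t + 1) powr a = (t + 1) powr (a - real k) * (t + 1) ^ k"
        using that by (simp add: powr_diff powr_realpow)
      then show ?thesis
        by (simp add: R True poly_power add.commute)
    qed (simp add: True)
    ultimately show ?thesis by (rule continuous_on_eq)
  next
    case False
    then show ?thesis
      using assms(2) by (intro continuous_intros continuous_on_powr') auto
  qed
qed

definition falling :: "real \<Rightarrow> nat \<Rightarrow> real" where
  "falling a n = (\<Prod>k<n. a - real k)"

text \<open>Here \<open>n\<close>-fold integration by parts is applied to the derivatives
  \<open>falling a k * (t + s) powr (a - k)\<close>, which may blow up at -1 when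
  \<open>s = 1\<close>.\<close>

lemma legendre_fourier_powr:
  fixes a s :: real
  assumes "a > 0" "s \<ge> 1"
  shows "legendre_fourier (\<lambda>t. (t + s) powr a) n = (real n + 1/2) * ((- 1) ^ n * falling a n *
    integral {-1..1} (\<lambda>t. (t + s) powr (a - real n) * (t\<^sup>2 - 1) ^ n) / (2 ^ n * fact n))"
proof -
  have "integral {-1..1} (\<lambda>t. falling a 0 * (t + s) powr (a - real 0) * poly (rodrigues n n) t) =
    (- 1) ^ n * integral {-1..1} (\<lambda>t. falling a n * (t + s) powr (a - real n) * poly (rodrigues n 0) t)"
  proof (rule integral_mult_rodrigues[of n "\<lambda>k t. falling a k * (t + s) powr (a - real k)"])
    show "((\<lambda>t. falling a k * (t + s) powr (a - real k)) has_real_derivative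
        falling a (Suc k) * (t + s) powr (a - real (Suc k))) (at t)" if "t \<in> {-1<..<1}" for k t
      using assms that
      by (auto intro!: derivative_eq_intros simp: falling_def algebra_simps)
    show "continuous_on {-1..1} (\<lambda>t. falling a k * (t + s) powr (a - real k) * poly p t)"
      if "[:1, 1:] ^ k dvd p" for k p
      unfolding mult.assoc
      by (intro continuous_on_mult_left continuous_on_shifted_powr_mult_poly assms that)
  qed
  moreover have "poly (rodrigues n 0) t = (t\<^sup>2 - 1) ^ n" for t
    by (simp add: poly_power power2_eq_square)
  ultimately show ?thesis
    by (simp add: legendre_fourier_def integral_mult_legendre falling_def mult.assoc)
qed

section \<open>Absolute summability of the coefficients\<close>

text \<open>A Beta integral up to a power of 2. The integrand is the absolute value of (t + 1) powr
  (a - n) * (t^2 - 1)^n, the case \<open>s = 1\<close>.\<close>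

definition powr_weight :: "real \<Rightarrow> nat \<Rightarrow> real" where
  "powr_weight a n = integral {-1..1} (\<lambda>t. (1 + t) powr a * (1 - t) ^ n)"

lemma powr_weight_integrable:
  assumes "a > 0"
  shows "(\<lambda>t::real. (1 + t) powr a * (1 - t) ^ n) integrable_on {-1..1}"
  using assms by (intro integrable_continuous_real continuous_intros continuous_on_powr') auto

lemma powr_weight_nonneg: "powr_weight a n \<ge> 0"
proof (cases "(\<lambda>t::real. (1 + t) powr a * (1 - t) ^ n) integrable_on {-1..1}")
  case True
  then show ?thesis unfolding powr_weight_def by (rule integral_nonneg) auto
\<comment> \<open>The integral of a non-integrable function is 0 by default.\<close>
qed (simp add: powr_weight_def not_integrable_integral)

text \<open>Integrate the derivative of (1 + t) powr (a + 1) * (1 - t)^(n+1), which vanishes at both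
  endpoints; writing 1 + t = 2 - (1 - t) expresses it through the two weights.\<close>

lemma powr_weight_Suc:
  assumes "a > 0"
  shows "(a + real n + 2) * powr_weight a (Suc n) = 2 * (real n + 1) * powr_weight a n"
proof -
  let ?f = "\<lambda>n t::real. (1 + t) powr a * (1 - t) ^ n"
  have "((\<lambda>t. (a + real n + 2) * ?f (Suc n) t - 2 * (real n + 1) * ?f n t) has_integral
      (1 + 1) powr (a + 1) * (1 - 1) ^ Suc n - (1 + (-1)) powr (a + 1) * (1 - (-1)) ^ Suc n) {-1..1}"
  proof (rule fundamental_theorem_of_calculus_interior)
    show "continuous_on {-1..1} (\<lambda>t::real. (1 + t) powr (a + 1) * (1 - t) ^ Suc n)"
      using assms by (intro continuous_intros continuous_on_powr') auto
    show "((\<lambda>t. (1 + t) powr (a + 1) * (1 - t) ^ Suc n) has_vector_derivative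
        (a + real n + 2) * ?f (Suc n) t - 2 * (real n + 1) * ?f n t) (at t)"
      if "t \<in> {-1<..<1}" for t
    proof -
      have "((\<lambda>t. (1 + t) powr (a + 1) * (1 - t) ^ Suc n) has_real_derivative
        (a + 1) * (1 + t) powr a * (1 - t) ^ Suc n
          - (1 + t) powr (a + 1) * ((real n + 1) * (1 - t) ^ n)) (at t)"
        using that by (auto intro!: derivative_eq_intros simp del: power_Suc)
      also have "(1 + t) powr (a + 1) = (1 + t) powr a * (1 + t)"
        using that by (simp add: powr_add)
      also have "(a + 1) * (1 + t) powr a * (1 - t) ^ Suc n
          - (1 + t) powr a * (1 + t) * ((real n + 1) * (1 - t) ^ n) =
         (a + real n + 2) * ?f (Suc n) t - 2 * (real n + 1) * ?f n t"
        by (simp add: algebra_simps)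
      finally show ?thesis
        by (simp add: has_real_derivative_iff_has_vector_derivative)
    qed
  qed auto
  moreover have "((\<lambda>t. (a + real n + 2) * ?f (Suc n) t - 2 * (real n + 1) * ?f n t) has_integral
      (a + real n + 2) * powr_weight a (Suc n) - 2 * (real n + 1) * powr_weight a n) {-1..1}"
    unfolding powr_weight_def
    by (intro has_integral_diff has_integral_mult_right integrable_integral powr_weight_integrable assms)
  ultimately have "(a + real n + 2) * powr_weight a (Suc n) - 2 * (real n + 1) * powr_weight a n =
    (1 + 1) powr (a + 1) * (1 - 1) ^ Suc n - (1 + (-1)) powr (a + 1) * (1 - (-1)) ^ Suc n"
    using has_integral_unique by blast
  then show ?thesis using assms by simp
qed

text \<open>These are the absolute Legendre coefficients of (t + 1) powr a and serve as majorant for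
  every \<open>s \<ge> 1\<close>.\<close>

lemma summable_falling_powr_weight:
  assumes "a > 0"
  shows "summable (\<lambda>n. (real n + 1/2) * (\<bar>falling a n\<bar> * powr_weight a n / (2 ^ n * fact n)))"
proof -
  define b where "b n = \<bar>falling a n\<bar> * powr_weight a n / (2 ^ n * fact n)" for n
  txt \<open>Since \<open>b (n + 1) / b n = (n - a) / (n + a + 2)\<close>, this choice of \<open>w\<close> telescopes to the
    summands.\<close>
  define w where "w n = real n * (real n + a + 1) * b n / (2 * a)" for n
  \<comment> \<open>From \<open>N\<close> on, \<open>n - a\<close> is nonnegative, so the absolute
    value in \<open>b\<close> resolves with a fixed sign.\<close>
  define N where "N = nat \<lceil>a\<rceil>"
  have N: "real n \<ge> a" if "n \<ge> N" for n
    using that unfolding N_def by linarith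
  have b: "b n \<ge> 0" for n
    by (simp add: b_def powr_weight_nonneg)
  have b_Suc: "b (Suc n) * (a + real n + 2) = b n * (real n - a)" if "n \<ge> N" for n
  proof -
    have "\<bar>falling a (Suc n)\<bar> = \<bar>falling a n\<bar> * (real n - a)"
      using N[OF that] by (simp add: falling_def abs_mult)
    then have "b (Suc n) * (a + real n + 2) =
      \<bar>falling a n\<bar> * (real n - a) * ((a + real n + 2) * powr_weight a (Suc n)) / (2 ^ Suc n * fact (Suc n))"
      by (simp add: b_def)
    also have "\<dots> = b n * (real n - a)"
    proof -
      define Y where "Y = 2 * (real n + 1)"
      have eq: "2 ^ Suc n * fact (Suc n) = Y * (2 ^ n * fact n)" and "Y \<noteq> 0"
        by (simp_all add: Y_def algebra_simps)
      then show ?thesis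
        unfolding powr_weight_Suc[OF assms] Y_def[symmetric] eq by (simp add: b_def)
    qed
    finally show ?thesis .
  qed
  have w_diff: "w n - w (Suc n) = (real n + 1/2) * b n" if "n \<ge> N" for n
  proof -
    have "2 * a * w k = real k * (real k + a + 1) * b k" for k
      using assms by (simp add: w_def)
    then have "2 * a * (w n - w (Suc n)) =
      real n * (real n + a + 1) * b n - (real n + 1) * (b (Suc n) * (a + real n + 2))"
      by (simp only: right_diff_distrib) (simp add: algebra_simps)
    also have "\<dots> = 2 * a * ((real n + 1/2) * b n)"
      unfolding b_Suc[OF that] by (simp add: algebra_simps)
    finally show ?thesis using assms by simp
  qed
  \<comment> \<open>Decreasing and nonnegative, \<open>w\<close> converges, hence its differences
    are summable.\<close>
  have "decseq (\<lambda>n. w (n + N))"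
  proof (rule decseq_SucI)
    show "w (Suc n + N) \<le> w (n + N)" for n
      using w_diff[of "n + N"] b[of "n + N"]
      by (smt (verit) add_Suc le_add2 mult_nonneg_nonneg of_nat_0_le_iff zero_le_divide_1_iff)
  qed
  moreover have "w (n + N) \<ge> 0" for n
    using assms b by (simp add: w_def)
  ultimately obtain L where "(\<lambda>n. w (n + N)) \<longlonglongrightarrow> L"
    using decseq_convergent by blast
  then have "summable (\<lambda>n. w (n + N) - w (Suc n + N))"
    by (rule telescope_summable')
  then have "summable (\<lambda>n. (real (n + N) + 1/2) * b (n + N))"
    using w_diff by simp
  then show ?thesis
    unfolding b_def by (rule summable_iff_shift[THEN iffD1])
qed

lemma summable_legendre_fourier_powr:
  assumes "a > 0" "s \<ge> 1"
  shows "summable (\<lambda>n. \<bar>legendre_fourier (\<lambda>t. (t + s) powr a) n\<bar>)"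
proof (rule summable_comparison_test'[OF summable_falling_powr_weight[OF assms(1)]])
  \<comment> \<open>Beyond this index \<open>a - n\<close> is negative, so replacing
    \<open>s\<close> by 1 enlarges the power; also \<open>n > 0\<close>, so (t^2 - 1)^n is 0 at
    -1.\<close>
  fix n assume n: "n \<ge> Suc (nat \<lceil>a\<rceil>)"
  then have na: "real n > a" by linarith
  let ?f = "\<lambda>t. (t + s) powr (a - real n) * (t\<^sup>2 - 1) ^ n"
  have "\<bar>integral {-1..1} ?f\<bar> \<le> powr_weight a n"
    unfolding powr_weight_def real_norm_def[symmetric]
  proof (rule integral_norm_bound_integral)
    have "[:1, 1:] ^ n dvd ([:-1, 0, 1:] :: real poly) ^ n"
      by (simp add: rodrigues_factor)
    from continuous_on_shifted_powr_mult_poly[OF assms this]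
    show "?f integrable_on {-1..1}"
      by (intro integrable_continuous_real) (simp add: poly_power power2_eq_square)
    show "norm (?f t) \<le> (1 + t) powr a * (1 - t) ^ n" if t: "t \<in> {-1..1}" for t
    proof (cases "t = -1")
      case True
      then show ?thesis using n by (simp add: zero_power)
    next
      case False
      with t have t1: "1 + t > 0" by auto
      have "t\<^sup>2 - 1 = - ((1 + t) * (1 - t))"
        by (simp add: algebra_simps power2_eq_square)
      then have "\<bar>t\<^sup>2 - 1\<bar> = (1 + t) * (1 - t)"
        using t by (simp only: abs_minus_cancel abs_mult) simp
      then have "norm (?f t) = (t + s) powr (a - real n) * ((1 + t) ^ n * (1 - t) ^ n)"
        by (simp add: abs_mult power_abs power_mult_distrib)
      also have "\<dots> \<le> (1 + t) powr (a - real n) * ((1 + t) ^ n * (1 - t) ^ n)"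
        using na t1 assms t by (intro mult_right_mono powr_mono2') auto
      also have "\<dots> = (1 + t) powr a * (1 - t) ^ n"
        using t1 by (simp add: powr_diff powr_realpow)
      finally show ?thesis .
    qed
  qed (rule powr_weight_integrable[OF assms(1)])
  then show "norm \<bar>legendre_fourier (\<lambda>t. (t + s) powr a) n\<bar> \<le>
    (real n + 1/2) * (\<bar>falling a n\<bar> * powr_weight a n / (2 ^ n * fact n))"
    unfolding legendre_fourier_powr[OF assms]
    by (auto simp: abs_mult power_abs intro!: mult_left_mono divide_right_mono)
qed

lemma summable_legendre_fourier_poly:
  "summable (\<lambda>n. \<bar>legendre_fourier (poly p) n\<bar>)"
  by (rule summable_finite[of "{..degree p}"])
    (auto simp: legendre_fourier_def integral_poly_mult_legendre_eq_0)

section \<open>Transfer from [-1, 1] to [\<alpha>, \<beta>]\<close>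

lemma legendre_fourier_cmult:
  "legendre_fourier (\<lambda>t. c * g t) n = c * legendre_fourier g n"
  by (simp add: legendre_fourier_def mult.assoc)

text \<open>Substitute x = m t + c, which maps [-1, 1] onto [\<alpha>, \<beta>]; the factor 1 / m is
  the \<open>2 / (\<beta> - \<alpha>)\<close> of \<open>legendre_coeff\<close>.\<close>

lemma legendre_coeff_eq_legendre_fourier:
  assumes "\<alpha> < \<beta>" "continuous_on {\<alpha>..\<beta>} (\<lambda>x. real_power x (real j - \<nu>))"
  shows "legendre_coeff \<nu> \<alpha> \<beta> i j =
    legendre_fourier (\<lambda>t. real_power ((\<beta> - \<alpha>) / 2 * t + (\<alpha> + \<beta>) / 2) (real j - \<nu>)) i"
proof -
  define m where "m = (\<beta> - \<alpha>) / 2"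
  define c where "c = (\<alpha> + \<beta>) / 2"
  define f where "f x = real_power x (real j - \<nu>) * shifted_legendre \<alpha> \<beta> i x" for x
  have m: "m > 0" using assms by (simp add: m_def)
  have "continuous_on {\<alpha>..\<beta>} f"
    unfolding f_def shifted_legendre_def
    by (intro continuous_intros assms(2))
  then have "(f has_integral integral {\<alpha>..\<beta>} f) (cbox \<alpha> \<beta>)"
    by (simp add: integrable_integral integrable_continuous_real)
  from has_integral_affinity'[OF this m, of c]
  have "((\<lambda>t. f (m * t + c)) has_integral integral {\<alpha>..\<beta>} f / m) {(\<alpha> - c) / m..(\<beta> - c) / m}"
    by (simp add: divide_inverse mult.commute)
  moreover have "(\<alpha> - c) / m = -1" "(\<beta> - c) / m = 1"
    using assms(1) by (simp_all add: c_def m_def field_simps)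
  ultimately have "integral {-1..1} (\<lambda>t. f (m * t + c)) = integral {\<alpha>..\<beta>} f / m"
    by (simp add: integral_unique)
  moreover have "2 / (\<beta> - \<alpha>) * (m * t + c - \<beta>) + 1 = t" for t
    using assms(1) by (simp add: m_def c_def field_simps)
  ultimately have "integral {\<alpha>..\<beta>} f / m = integral {-1..1}
      (\<lambda>t. real_power (m * t + c) (real j - \<nu>) * poly (legendre_poly i) t)"
    by (simp add: f_def shifted_legendre_def)
  moreover have "legendre_coeff \<nu> \<alpha> \<beta> i j = (real i + 1/2) * (integral {\<alpha>..\<beta>} f / m)"
    by (simp add: legendre_coeff_def f_def[abs_def] m_def)
  ultimately show ?thesis
    by (simp add: legendre_fourier_def m_def c_def)
qed

lemma real_power_of_nat: "real_power x (real k) = x ^ k"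
  by (simp add: real_power_def)

lemma real_power_legendre_sums:
  assumes "\<alpha> < \<beta>" "0 \<le> \<alpha> \<or> \<nu> \<in> \<int>" "\<nu> \<le> real j" "x \<in> {\<alpha>..\<beta>}"
  shows "(\<lambda>i. legendre_coeff \<nu> \<alpha> \<beta> i j * shifted_legendre \<alpha> \<beta> i x) sums real_power x (real j - \<nu>)"
proof -
  define m where "m = (\<beta> - \<alpha>) / 2"
  define c where "c = (\<alpha> + \<beta>) / 2"
  define a where "a = real j - \<nu>"
  define g where "g t = real_power (m * t + c) a" for t
  define t where "t = 2 / (\<beta> - \<alpha>) * (x - \<beta>) + 1"
  have m: "m > 0" using assms by (simp add: m_def)
  have x: "m * t + c = x" using assms(1) by (simp add: m_def c_def t_def field_simps)
  have t: "t \<in> {-1..1}" using assms(1,4) by (auto simp: t_def field_simps)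
  have "continuous_on {\<alpha>..\<beta>} (\<lambda>x. real_power x a) \<and> continuous_on {-1..1} g \<and>
    summable (\<lambda>i. \<bar>legendre_fourier g i\<bar>)"
  proof (cases "\<nu> \<in> \<int>")
    case True
    then have "a \<in> \<int>" by (simp add: a_def)
    moreover have "a \<ge> 0" using assms by (simp add: a_def)
    ultimately obtain k where k: "a = real k" by (metis Ints_cases nonneg_int_cases of_int_0_le_iff of_int_of_nat_eq)
    have "g = poly ([:c, m:] ^ k)"
      by (auto simp: g_def k real_power_of_nat poly_power algebra_simps)
    then show ?thesis
      using summable_legendre_fourier_poly
      by (auto simp: k real_power_of_nat intro!: continuous_intros)
  next
    case False
    then have ai: "a \<notin> \<int>"
      by (metis Ints_diff Ints_of_nat a_def diff_diff_eq2 add_diff_cancel_left')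
    moreover have "a \<ge> 0" using assms by (simp add: a_def)
    ultimately have a: "a > 0" by (cases "a = 0") auto
    \<comment> \<open>Factoring out \<open>m\<close> gives m t + c = m (t + s), where s = (\<alpha>
      + \<beta>) / (\<beta> - \<alpha>) is at least 1 because
      \<open>\<alpha> \<ge> 0\<close>.\<close>
    define s where "s = c / m"
    have \<alpha>: "\<alpha> \<ge> 0" using assms False by auto
    then have s: "s \<ge> 1" using m by (simp add: s_def m_def c_def field_simps)
    have g: "g t = m powr a * (t + s) powr a" if "t \<in> {-1..1}" for t
    proof -
      have "m * t + c = m * (t + s)" using m by (simp add: s_def field_simps)
      then show ?thesis
        using ai m that s by (simp add: g_def real_power_def powr_mult)
    qed
    have "continuous_on {-1..1} (\<lambda>t. m powr a * (t + s) powr a)"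
      using a s by (intro continuous_intros continuous_on_powr') auto
    then have "continuous_on {-1..1} g"
      by (rule continuous_on_eq) (simp add: g)
    moreover have "legendre_fourier g i = m powr a * legendre_fourier (\<lambda>t. (t + s) powr a) i" for i
      unfolding legendre_fourier_cmult[symmetric] unfolding legendre_fourier_def
      by (intro arg_cong2[where f = "(*)"] refl integral_cong) (simp add: g)
    moreover have "continuous_on {\<alpha>..\<beta>} (\<lambda>x. real_power x a)"
      using ai a \<alpha> by (auto simp: real_power_def intro!: continuous_intros continuous_on_powr')
    ultimately show ?thesis
      using summable_legendre_fourier_powr[OF a s] by (simp add: abs_mult)
  qed
  then have cont: "continuous_on {\<alpha>..\<beta>} (\<lambda>x. real_power x a)"
    and cont': "continuous_on {-1..1} g" and sum: "summable (\<lambda>i. \<bar>legendre_fourier g i\<bar>)" by auto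
  have "legendre_coeff \<nu> \<alpha> \<beta> i j = legendre_fourier g i" for i
    using legendre_coeff_eq_legendre_fourier[OF assms(1) cont[unfolded a_def]]
    by (simp add: g_def[abs_def] m_def c_def a_def)
  moreover have "shifted_legendre \<alpha> \<beta> i x = poly (legendre_poly i) t" for i
    by (simp add: shifted_legendre_def t_def)
  moreover have "g t = real_power x (real j - \<nu>)"
    by (simp add: g_def a_def x)
  ultimately show ?thesis
    using legendre_series_sums[OF cont' sum t] by simp
qed

subsection \<open>Caputo derivatives of polynomials\<close>

lemma higher_deriv_poly:
  fixes p :: "real poly"
  shows "(deriv ^^ m) (poly p) = poly ((pderiv ^^ m) p)"
proof -
  have "deriv (poly q) = poly (pderiv q)" for q :: "real poly"
    by (rule ext) (rule DERIV_imp_deriv[OF poly_DERIV])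
  then show ?thesis by (induction m) simp_all
qed

text \<open>The substitution t = x u reduces this to Euler's Beta integral.\<close>

lemma has_integral_powr_mult_power:
  fixes x b :: real
  assumes "x \<ge> 0" "b > 0"
  shows "((\<lambda>t. (x - t) powr (b - 1) * t ^ i) has_integral
    x powr (b + real i) * Beta (real i + 1) b) {0..x}"
proof (cases "x = 0")
  case True
  then show ?thesis by (simp add: has_integral_refl)
next
  case False
  then have x: "x > 0" using assms by simp
  have "((\<lambda>u. u powr (real i + 1 - 1) * (1 - u) powr (b - 1)) has_integral Beta (real i + 1) b) (cbox 0 1)"
    using has_integral_Beta_real[of "real i + 1" b] assms by simp
  from has_integral_affinity'[OF this, of "1 / x" 0]
  have "((\<lambda>t. (t / x) powr real i * (1 - t / x) powr (b - 1)) has_integral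
      x * Beta (real i + 1) b) {0..x}"
    using x by simp
  then have *: "((\<lambda>t. x powr (b - 1 + real i) * ((t / x) powr real i * (1 - t / x) powr (b - 1)))
      has_integral x powr (b - 1 + real i) * (x * Beta (real i + 1) b)) {0..x}"
    by (rule has_integral_mult_right)
  have "((\<lambda>t. (x - t) powr (b - 1) * t ^ i) has_integral
      x powr (b - 1 + real i) * (x * Beta (real i + 1) b)) {0..x}"
  proof (rule has_integral_spike_finite[OF _ _ *])
    \<comment> \<open>The point 0 is excluded because for \<open>i = 0\<close> the integrands differ
      there: \<open>0 powr 0 = 0\<close> but \<open>0 ^ 0 = 1\<close>.\<close>
    show "finite {0 :: real}" by simp
    fix t assume t: "t \<in> {0..x} - {0}"
    have "x powr (b - 1) * (1 - t / x) powr (b - 1) = (x * (1 - t / x)) powr (b - 1)"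
      using t x by (subst powr_mult) auto
    also have "x * (1 - t / x) = x - t" using x by (simp add: field_simps)
    finally have 1: "x powr (b - 1) * (1 - t / x) powr (b - 1) = (x - t) powr (b - 1)" .
    have 2: "x powr real i * (t / x) powr real i = t ^ i"
      using t x by (simp add: powr_realpow power_divide)
    show "(x - t) powr (b - 1) * t ^ i =
        x powr (b - 1 + real i) * ((t / x) powr real i * (1 - t / x) powr (b - 1))"
      unfolding 1[symmetric] 2[symmetric] powr_add by (simp add: mult_ac)
  qed
  moreover have "x powr (b + real i) = x powr (b - 1 + real i) * x"
    using x powr_add[of x "b - 1 + real i" 1] by simp
  ultimately show ?thesis by (simp add: mult.assoc)
qed

text \<open>For \<open>b < 1\<close> the kernel is unbounded near \<open>t = x\<close>, so
  integrability comes from the Beta integrals of the monomials. It is what makes the Caputo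
  derivative additive.\<close>

lemma powr_mult_poly_integrable:
  fixes x b :: real
  assumes "x \<ge> 0" "b > 0"
  shows "(\<lambda>t. (x - t) powr (b - 1) * poly p t) integrable_on {0..x}"
proof -
  have "(\<lambda>t. \<Sum>i\<le>degree p. coeff p i * ((x - t) powr (b - 1) * t ^ i)) integrable_on {0..x}"
    by (intro integrable_sum integrable_on_mult_right
        has_integral_integrable[OF has_integral_powr_mult_power] assms) simp
  then show ?thesis
    by (simp add: poly_altdef sum_distrib_left mult_ac)
qed

lemma caputo_order_pos:
  fixes \<nu> :: real
  assumes "\<nu> \<notin> \<int>" "\<nu> > 0"
  shows "real (nat \<lceil>\<nu>\<rceil>) - \<nu> > 0"
proof -
  have "\<nu> \<noteq> of_int \<lceil>\<nu>\<rceil>" using assms(1) by (metis Ints_of_int)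
  moreover have "real (nat \<lceil>\<nu>\<rceil>) = of_int \<lceil>\<nu>\<rceil>" using assms(2) by simp
  ultimately show ?thesis using le_of_int_ceiling[of \<nu>] by linarith
qed

lemma caputo_deriv_poly_add:
  assumes "\<nu> > 0" "x \<ge> 0 \<or> \<nu> \<in> \<int>"
  shows "caputo_deriv \<nu> (poly (p + q)) x = caputo_deriv \<nu> (poly p) x + caputo_deriv \<nu> (poly q) x"
proof (cases "\<nu> \<in> \<int>")
  case True
  then show ?thesis
    by (simp add: caputo_deriv_def Let_def higher_deriv_poly higher_pderiv_add)
next
  case False
  define b where "b = real (nat \<lceil>\<nu>\<rceil>) - \<nu>"
  have b: "b > 0" unfolding b_def using False assms(1) by (rule caputo_order_pos)
  have "integral {0..x} (\<lambda>t. (x - t) powr (b - 1) * poly ((pderiv ^^ nat \<lceil>\<nu>\<rceil>) (p + q)) t) =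
    integral {0..x} (\<lambda>t. (x - t) powr (b - 1) * poly ((pderiv ^^ nat \<lceil>\<nu>\<rceil>) p) t) +
    integral {0..x} (\<lambda>t. (x - t) powr (b - 1) * poly ((pderiv ^^ nat \<lceil>\<nu>\<rceil>) q) t)"
    using assms(2) False b
    by (simp add: higher_pderiv_add distrib_left Henstock_Kurzweil_Integration.integral_add
        powr_mult_poly_integrable)
  then show ?thesis
    using False by (simp add: caputo_deriv_def Let_def higher_deriv_poly b_def add_divide_distrib)
qed

lemma caputo_deriv_poly_sum:
  assumes "\<nu> > 0" "x \<ge> 0 \<or> \<nu> \<in> \<int>"
  shows "caputo_deriv \<nu> (poly (\<Sum>a\<in>A. p a)) x = (\<Sum>a\<in>A. caputo_deriv \<nu> (poly (p a)) x)"
proof -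
  have zero: "caputo_deriv \<nu> (poly 0) x = 0"
    by (simp only: caputo_deriv_def Let_def higher_deriv_poly) simp
  show ?thesis
  proof (induction A rule: infinite_finite_induct)
    case (insert a A)
    then show ?case
      by (simp only: sum.insert[OF insert.hyps] caputo_deriv_poly_add[OF assms])
  qed (simp_all only: sum.infinite sum.empty not_False_eq_True zero)
qed

text \<open>After \<open>m\<close> ordinary derivatives, the fractional integral of t^(j - m) is a
  Beta value: its Gamma(m - \<nu>) cancels the prefactor and its Gamma(j - m + 1) cancels the
  factorial. For integer \<nu> the claim is the ordinary derivative, with Gamma(j + 1 - \<nu>) = (j
  - m)!.\<close>

lemma caputo_deriv_monom:
  assumes "\<nu> > 0" "x \<ge> 0 \<or> \<nu> \<in> \<int>"
  shows "caputo_deriv \<nu> (poly (monom c j)) x =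
    (if j < nat \<lceil>\<nu>\<rceil> then 0 else c * fact j / Gamma (real j + 1 - \<nu>) * real_power x (real j - \<nu>))"
proof (cases "j < nat \<lceil>\<nu>\<rceil>")
  case True
  then have "(pderiv ^^ nat \<lceil>\<nu>\<rceil>) (monom c j) = 0"
    by (intro higher_pderiv_eq_0) (metis degree_monom_le le_less_trans)
  with True show ?thesis
    by (simp add: caputo_deriv_def Let_def higher_deriv_poly)
next
  case False
  define m where "m = nat \<lceil>\<nu>\<rceil>"
  have mj: "m \<le> j" using False by (simp only: m_def not_less)
  have D: "(deriv ^^ m) (poly (monom c j)) = (\<lambda>t. fact j / fact (j - m) * c * t ^ (j - m))"
    by (simp add: higher_deriv_poly higher_pderiv_monom_fact mj poly_monom fun_eq_iff)
  have Gamma: "Gamma (real (j - m) + 1) = fact (j - m)"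
    by (simp add: Gamma_fact add.commute)
  show ?thesis
  proof (cases "\<nu> \<in> \<int>")
    case True
    then have \<nu>: "\<nu> = real m"
      using assms(1) by (auto simp: m_def elim!: Ints_cases)
    have "real j - \<nu> = real (j - m)" "real j + 1 - \<nu> = real (j - m) + 1"
      using mj by (auto simp: \<nu> of_nat_diff)
    then have "c * fact j / Gamma (real j + 1 - \<nu>) * real_power x (real j - \<nu>) =
        fact j / fact (j - m) * c * x ^ (j - m)"
      by (simp only: Gamma real_power_of_nat) simp
    moreover have "caputo_deriv \<nu> (poly (monom c j)) x = fact j / fact (j - m) * c * x ^ (j - m)"
      using True by (simp only: caputo_deriv_def Let_def if_True m_def[symmetric] D)
    ultimately show ?thesis using False by (simp only: if_False)
  next
    case nonint: False
    define b where "b = real m - \<nu>"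
    have b: "b > 0" unfolding b_def m_def using nonint assms(1) by (rule caputo_order_pos)
    have "Gamma b \<noteq> 0" using Gamma_real_pos[OF b] by linarith
    have x: "x \<ge> 0" using nonint assms(2) by simp
    have "integral {0..x} (\<lambda>t. (x - t) powr (b - 1) * (deriv ^^ m) (poly (monom c j)) t) =
      integral {0..x} (\<lambda>t. fact j / fact (j - m) * c * ((x - t) powr (b - 1) * t ^ (j - m)))"
      by (simp add: D mult_ac)
    also have "\<dots> = fact j / fact (j - m) * c *
        (x powr (b + real (j - m)) * Beta (real (j - m) + 1) b)"
      using has_integral_powr_mult_power[OF x b, of "j - m"]
      by (subst integral_mult_right) (simp add: integral_unique)
    also have "\<dots> = fact j * c * x powr (real j - \<nu>) * Gamma b / Gamma (real j + 1 - \<nu>)"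
    proof -
      have eqs: "b + real (j - m) = real j - \<nu>" "real (j - m) + 1 + b = real j + 1 - \<nu>"
        using mj by (auto simp: b_def of_nat_diff)
      show ?thesis unfolding Beta_def eqs Gamma by simp
    qed
    finally have I: "integral {0..x} (\<lambda>t. (x - t) powr (b - 1) * (deriv ^^ m) (poly (monom c j)) t) =
      fact j * c * x powr (real j - \<nu>) * Gamma b / Gamma (real j + 1 - \<nu>)" .
    have "real j - \<nu> \<notin> \<int>"
      using nonint by (metis Ints_diff Ints_of_nat add_diff_cancel_left' diff_diff_eq2)
    then show ?thesis
      using False nonint \<open>Gamma b \<noteq> 0\<close>
      by (simp add: caputo_deriv_def Let_def real_power_def I flip: m_def b_def)
  qed
qed

subsection \<open>Monomial expansion of the shifted polynomials\<close>

text \<open>Expand (X^2 - 1)^n binomially and differentiate \<open>n\<close> times; terms of degree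
  \<open>2 * (n - k) < n\<close> disappear, which leaves \<open>k \<le> n div 2\<close>.\<close>

lemma legendre_poly_expansion:
  "legendre_poly n = (\<Sum>k = 0..n div 2. monom ((- 1) ^ k * fact (2 * n - 2 * k) /
     (2 ^ n * fact (n - k) * fact k * fact (n - 2 * k))) (n - 2 * k))"
proof -
  have "[:-1, 0, 1:] = [:-1:] + (monom 1 2 :: real poly)"
    by (simp add: monom_altdef power2_eq_square)
  then have "[:-1, 0, 1:] ^ n =
      (\<Sum>k\<le>n. monom (of_nat (n choose k) * (- 1) ^ k) (2 * (n - k)) :: real poly)"
    by (simp add: binomial_ring monom_power smult_monom poly_const_pow of_nat_poly mult.commute)
  then have "(pderiv ^^ n) ([:-1, 0, 1:] ^ n) =
      (\<Sum>k\<le>n. (pderiv ^^ n) (monom (of_nat (n choose k) * (- 1) ^ k) (2 * (n - k)) :: real poly))"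
    by (simp add: higher_pderiv_sum)
  also have "\<dots> = (\<Sum>k = 0..n div 2. (pderiv ^^ n) (monom (of_nat (n choose k) * (- 1) ^ k) (2 * (n - k))))"
  proof (rule sum.mono_neutral_right)
    show "\<forall>k\<in>{..n} - {0..n div 2}.
        (pderiv ^^ n) (monom (of_nat (n choose k) * (- 1) ^ k) (2 * (n - k)) :: real poly) = 0"
    proof
      fix k assume "k \<in> {..n} - {0..n div 2}"
      then have "2 * (n - k) < n" by auto
      then show "(pderiv ^^ n) (monom (of_nat (n choose k) * (- 1) ^ k) (2 * (n - k)) :: real poly) = 0"
        by (intro higher_pderiv_eq_0) (metis degree_monom_le le_less_trans)
    qed
  qed auto
  finally have "legendre_poly n = (\<Sum>k = 0..n div 2. smult (1 / (2 ^ n * fact n))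
      ((pderiv ^^ n) (monom (of_nat (n choose k) * (- 1) ^ k) (2 * (n - k)))))"
    unfolding legendre_poly_def by (intro poly_eqI) (simp add: coeff_sum sum_distrib_left)
  also have "\<dots> = (\<Sum>k = 0..n div 2. monom ((- 1) ^ k * fact (2 * n - 2 * k) /
     (2 ^ n * fact (n - k) * fact k * fact (n - 2 * k))) (n - 2 * k))"
  proof (rule sum.cong[OF refl])
    fix k assume "k \<in> {0..n div 2}"
    then have k: "n \<le> 2 * (n - k)" "k \<le> n" "2 * (n - k) - n = n - 2 * k" by auto
    show "smult (1 / (2 ^ n * fact n))
        ((pderiv ^^ n) (monom (of_nat (n choose k) * (- 1) ^ k) (2 * (n - k)))) =
      (monom ((- 1) ^ k * fact (2 * n - 2 * k) /
        (2 ^ n * fact (n - k) * fact k * fact (n - 2 * k))) (n - 2 * k) :: real poly)"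
      unfolding higher_pderiv_monom_fact[OF k(1)] binomial_fact[OF k(2)] k(3) smult_monom
      by (simp add: diff_mult_distrib diff_mult_distrib2 field_simps)
  qed
  finally show ?thesis .
qed

text \<open>The contribution of \<open>k\<close> and \<open>l\<close> to the coefficient of x^j. It
  is the summand of \<open>S_coeff\<close> without \<open>legendre_coeff\<close> and without j! /
  Gamma(j + 1 - \<nu>), which is what differentiating x^j contributes.\<close>

definition shifted_legendre_term :: "real \<Rightarrow> real \<Rightarrow> nat \<Rightarrow> nat \<Rightarrow> nat \<Rightarrow> nat \<Rightarrow> real" where
  "shifted_legendre_term \<alpha> \<beta> n k l j =
     (-1) powi (int k - int j + int l) * 2 powi (int l - int n)
       * \<beta> ^ (l - j) * (\<beta> - \<alpha>) powi (- int l) * fact (2 * n - 2 * k)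
     / (fact (n - k) * fact k * fact (n - 2 * k - l) * fact j * fact (l - j))"

text \<open>The binomial theorem is used twice, for the powers of 2 / d * (x - \<beta>) + 1 and then
  for those of x - \<beta>.\<close>

lemma shifted_legendre_expansion:
  "shifted_legendre \<alpha> \<beta> n = poly (\<Sum>k = 0..n div 2. \<Sum>l = 0..n - 2 * k. \<Sum>j = 0..l.
      monom (shifted_legendre_term \<alpha> \<beta> n k l j) j)"
proof
  fix x
  define d where "d = \<beta> - \<alpha>"
  have pow: "(2 / d * (x - \<beta>) + 1) ^ N = (\<Sum>l = 0..N. \<Sum>j = 0..l.
      of_nat (N choose l) * (2 / d) ^ l * (of_nat (l choose j) * (- \<beta>) ^ (l - j)) * x ^ j)" for N
  proof -
    have "(2 / d * (x - \<beta>) + 1) ^ N = (\<Sum>l\<le>N. of_nat (N choose l) * (2 / d) ^ l * (x + - \<beta>) ^ l)"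
      by (subst binomial_ring)
        (simp only: power_mult_distrib power_one mult_1_right mult.assoc diff_conv_add_uminus)
    also have "\<dots> = (\<Sum>l\<le>N. \<Sum>j\<le>l.
      of_nat (N choose l) * (2 / d) ^ l * (of_nat (l choose j) * (- \<beta>) ^ (l - j)) * x ^ j)"
      by (simp only: binomial_ring[of x "- \<beta>"] sum_distrib_left mult_ac)
    finally show ?thesis by (simp only: atLeast0AtMost)
  qed
  have "shifted_legendre \<alpha> \<beta> n x = (\<Sum>k = 0..n div 2. \<Sum>l = 0..n - 2 * k. \<Sum>j = 0..l.
      (- 1) ^ k * fact (2 * n - 2 * k) / (2 ^ n * fact (n - k) * fact k * fact (n - 2 * k)) *
      (of_nat (n - 2 * k choose l) * (2 / d) ^ l * (of_nat (l choose j) * (- \<beta>) ^ (l - j)) * x ^ j))"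
    unfolding shifted_legendre_def legendre_poly_expansion d_def[symmetric]
    by (simp only: poly_sum poly_monom pow sum_distrib_left)
  also have "\<dots> = (\<Sum>k = 0..n div 2. \<Sum>l = 0..n - 2 * k. \<Sum>j = 0..l.
      shifted_legendre_term \<alpha> \<beta> n k l j * x ^ j)"
  proof (intro sum.cong refl)
    fix k l j assume "l \<in> {0..n - 2 * k}" "j \<in> {0..l}"
    then have l: "l \<le> n - 2 * k" and j: "j \<le> l" by auto
    \<comment> \<open>The sign combines \<open>(-1) ^ k\<close> from the monomial form of L_n with
      the one of \<open>(- \<beta>) ^ (l - j)\<close>.\<close>
    have s: "(-1 :: real) powi (int k - int j + int l) = (-1) ^ k * (-1) ^ (l - j)"
      using j by (simp add: power_int_add power_int_diff of_nat_diff flip: power_add)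
        (simp add: minus_one_power_iff)
    have t: "(2 :: real) powi (int l - int n) = 2 ^ l / 2 ^ n"
      by (simp add: power_int_diff)
    have u: "d powi (- int l) = 1 / d ^ l"
      by (simp add: power_int_minus divide_inverse)
    have v: "(- \<beta>) ^ (l - j) = (-1) ^ (l - j) * \<beta> ^ (l - j)"
      by (rule power_minus)
    show "(- 1) ^ k * fact (2 * n - 2 * k) / (2 ^ n * fact (n - k) * fact k * fact (n - 2 * k)) *
      (of_nat (n - 2 * k choose l) * (2 / d) ^ l * (of_nat (l choose j) * (- \<beta>) ^ (l - j)) * x ^ j) =
      shifted_legendre_term \<alpha> \<beta> n k l j * x ^ j"
      unfolding shifted_legendre_term_def d_def[symmetric] s t u v binomial_fact[OF l]
        binomial_fact[OF j]
      by (simp add: power_divide mult_ac)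
  qed
  also have "\<dots> = poly (\<Sum>k = 0..n div 2. \<Sum>l = 0..n - 2 * k. \<Sum>j = 0..l.
      monom (shifted_legendre_term \<alpha> \<beta> n k l j) j) x"
    by (simp add: poly_sum poly_monom)
  finally show "shifted_legendre \<alpha> \<beta> n x = \<dots>" .
qed

section \<open>Assembly: both sides as finite combinations of expansions of powers\<close>

theorem theorem3p2:
  fixes \<nu> \<alpha> \<beta> x :: real and n :: nat
  assumes "\<nu> > 0"
    and "\<alpha> < \<beta>"
    and "0 \<le> \<alpha> \<or> \<nu> \<in> \<int>"
    and "n \<ge> nat \<lceil>\<nu>\<rceil>"
    and "x \<in> {\<alpha>..\<beta>}"
  shows "(\<lambda>i. S_coeff \<nu> \<alpha> \<beta> n i * shifted_legendre \<alpha> \<beta> i x)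
           sums caputo_deriv \<nu> (shifted_legendre \<alpha> \<beta> n) x"
proof -
  define m where "m = nat \<lceil>\<nu>\<rceil>"
  define c where "c k l j = shifted_legendre_term \<alpha> \<beta> n k l j * fact j / Gamma (real j + 1 - \<nu>)" for k l j
  define t where "t k l j = c k l j * real_power x (real j - \<nu>)" for k l j
  have x: "x \<ge> 0 \<or> \<nu> \<in> \<int>" using assms(3,5) by auto
  have "S_coeff \<nu> \<alpha> \<beta> n i = (\<Sum>k = 0..n div 2. \<Sum>l = m..n - 2 * k. \<Sum>j = m..l.
      c k l j * legendre_coeff \<nu> \<alpha> \<beta> i j)" for i
    by (simp add: S_coeff_def m_def c_def shifted_legendre_term_def field_simps)
  then have "(\<lambda>i. S_coeff \<nu> \<alpha> \<beta> n i * shifted_legendre \<alpha> \<beta> i x) =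
    (\<lambda>i. \<Sum>k = 0..n div 2. \<Sum>l = m..n - 2 * k. \<Sum>j = m..l.
      c k l j * (legendre_coeff \<nu> \<alpha> \<beta> i j * shifted_legendre \<alpha> \<beta> i x))"
    by (simp add: sum_distrib_right mult.assoc)
  \<comment> \<open>Only finitely many series are combined, so summing termwise is legitimate;
    \<open>j \<ge> m\<close> provides the nonnegative exponent \<open>j - \<nu>\<close>.\<close>
  moreover have "\<dots> sums (\<Sum>k = 0..n div 2. \<Sum>l = m..n - 2 * k. \<Sum>j = m..l. t k l j)"
    unfolding t_def
  proof (intro sums_sum sums_mult real_power_legendre_sums assms)
    show "\<nu> \<le> real j" if "j \<in> {m..l}" for j l
      using that unfolding m_def by simp
  qed
  moreover have "caputo_deriv \<nu> (shifted_legendre \<alpha> \<beta> n) x =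
    (\<Sum>k = 0..n div 2. \<Sum>l = 0..n - 2 * k. \<Sum>j = 0..l. if j < m then 0 else t k l j)"
    unfolding shifted_legendre_expansion caputo_deriv_poly_sum[OF assms(1) x]
      caputo_deriv_monom[OF assms(1) x]
    by (intro sum.cong refl) (simp add: m_def t_def c_def)
  \<comment> \<open>The powers with \<open>j < m\<close> are annihilated by the derivative, and for
    \<open>l < m\<close> no \<open>j\<close> remains, so both sums may start at
    \<open>m\<close>.\<close>
  moreover have "(\<Sum>l = 0..N. \<Sum>j = 0..l. if j < m then 0 else t k l j) =
      (\<Sum>l = m..N. \<Sum>j = m..l. t k l j)" for k N
  proof -
    have "(\<Sum>j = 0..l. if j < m then 0 else t k l j) = (\<Sum>j = m..l. t k l j)" for l
      by (rule sum.mono_neutral_cong_right) auto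
    moreover have "(\<Sum>l = 0..N. \<Sum>j = m..l. t k l j) = (\<Sum>l = m..N. \<Sum>j = m..l. t k l j)"
      by (rule sum.mono_neutral_right) auto
    ultimately show ?thesis by simp
  qed
  ultimately show ?thesis by simp
qed

end
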